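(* Let $f\colon M\to M$ be a homeomorphism of a compact metric space $(M,d)$. If $f$ is cw-expansive and has a shadowing bracket, then $f$ is cw$_1$-expansive.
   Context: For $\delta>0$, $\Delta_\delta=\{(p,q)\in M^2: d(p,q)\le\delta\}$. For $\epsilon>0$ and $p\in M$, $W^s_\epsilon(p)=\{q: d(f^n(p),f^n(q))\le\epsilon\ \forall n\ge0\}$ and $W^u_\epsilon(p)=\{q: d(f^{-n}(p),f^{-n}(q))\le\epsilon\ \forall n\ge0\}$. A shadowing bracket is a continuous map $[\cdot,\cdot]\colon\Delta_\delta\to M$ (for some $\delta>0$) such that (1) $[p,p]=p$ for all $p\in M$; (2) for all $\epsilon>0$ there is $\gamma>0$ such that $d(p,q)\le\gamma$ implies $[p,q]\in W^s_\epsilon(q)\cap W^u_\epsilon(p)$. A continuum is a closed connected subset of $M$. $f$ is cw-expansive if there is $\xi>0$ such that if $C\subset M$ is a continuum and $\operatorname{diam}(f^i(C))\le\xi$ for all $i\in\mathbb Z$ then $C$ is a singleton. A continuum $C$ is $\epsilon$-stable if $\operatorname{diam}(f^n(C))\le\epsilon$ for all $n\ge0$, and $\epsilon$-unstable if $\operatorname{diam}(f^{-n}(C))\le\epsilon$ for all $n\ge0$. $f$ is cw$_1$-expansive if there is $\xi>0$ such that if $C_s$ is a $\xi$-stable continuum and $C_u$ is a $\xi$-unstable continuum then $C_s\cap C_u$ contains at most one point. *)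

theory Defs
  imports "HOL-Analysis.Analysis"
begin

text \<open>
  The space is a subset \<open>M\<close> of a metric-space type and the dynamics is a function \<open>f\<close>
  that is a homeomorphism of \<open>M\<close>; its values outside \<open>M\<close> play no role. The inverse
  map is \<open>inv_into M f\<close>.
\<close>

definition int_iterate :: "'a set \<Rightarrow> ('a \<Rightarrow> 'a) \<Rightarrow> int \<Rightarrow> 'a \<Rightarrow> 'a" where
  "int_iterate M f i = (if i \<ge> 0 then f ^^ nat i else inv_into M f ^^ nat (- i))"

definition local_stable :: "'a::metric_space set \<Rightarrow> ('a \<Rightarrow> 'a) \<Rightarrow> real \<Rightarrow> 'a \<Rightarrow> 'a set" where
  "local_stable M f \<epsilon> p =
     {q \<in> M. \<forall>n::nat. dist (int_iterate M f (int n) p) (int_iterate M f (int n) q) \<le> \<epsilon>}"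

definition local_unstable :: "'a::metric_space set \<Rightarrow> ('a \<Rightarrow> 'a) \<Rightarrow> real \<Rightarrow> 'a \<Rightarrow> 'a set" where
  "local_unstable M f \<epsilon> p =
     {q \<in> M. \<forall>n::nat. dist (int_iterate M f (- int n) p) (int_iterate M f (- int n) q) \<le> \<epsilon>}"

definition near_diagonal :: "'a::metric_space set \<Rightarrow> real \<Rightarrow> ('a \<times> 'a) set" where
  "near_diagonal M \<delta> = {(p, q) \<in> M \<times> M. dist p q \<le> \<delta>}"

text \<open>
  The bracket is only meaningful on \<open>near_diagonal M \<delta>\<close>, so \<open>\<gamma>\<close> is taken to be at most
  \<open>\<delta>\<close>; shrinking \<open>\<gamma>\<close> is always possible.
\<close>

definition shadowing_bracket ::
    "'a::metric_space set \<Rightarrow> ('a \<Rightarrow> 'a) \<Rightarrow> real \<Rightarrow> ('a \<times> 'a \<Rightarrow> 'a) \<Rightarrow> bool" where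
  "shadowing_bracket M f \<delta> B \<longleftrightarrow>
     \<delta> > 0 \<and>
     continuous_on (near_diagonal M \<delta>) B \<and>
     B ` near_diagonal M \<delta> \<subseteq> M \<and>
     (\<forall>p\<in>M. B (p, p) = p) \<and>
     (\<forall>\<epsilon>>0. \<exists>\<gamma>>0. \<gamma> \<le> \<delta> \<and>
        (\<forall>p\<in>M. \<forall>q\<in>M. dist p q \<le> \<gamma> \<longrightarrow>
           B (p, q) \<in> local_stable M f \<epsilon> q \<inter> local_unstable M f \<epsilon> p))"

definition has_shadowing_bracket :: "'a::metric_space set \<Rightarrow> ('a \<Rightarrow> 'a) \<Rightarrow> bool" where
  "has_shadowing_bracket M f \<longleftrightarrow> (\<exists>\<delta> B. shadowing_bracket M f \<delta> B)"

text \<open>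
  Continua are nonempty. The empty set satisfies \<open>connected\<close>, and admitting it would make
  cw-expansivity unsatisfiable, because it has diameter 0 but is not a singleton.
\<close>

definition continuum :: "'a::metric_space set \<Rightarrow> 'a set \<Rightarrow> bool" where
  "continuum M C \<longleftrightarrow> closedin (top_of_set M) C \<and> connected C \<and> C \<noteq> {}"

definition cw_expansive :: "'a::metric_space set \<Rightarrow> ('a \<Rightarrow> 'a) \<Rightarrow> bool" where
  "cw_expansive M f \<longleftrightarrow>
     (\<exists>\<xi>>0. \<forall>C. continuum M C \<and> (\<forall>i::int. diameter (int_iterate M f i ` C) \<le> \<xi>)
        \<longrightarrow> is_singleton C)"

definition stable_continuum :: "'a::metric_space set \<Rightarrow> ('a \<Rightarrow> 'a) \<Rightarrow> real \<Rightarrow> 'a set \<Rightarrow> bool" where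
  "stable_continuum M f \<epsilon> C \<longleftrightarrow>
     continuum M C \<and> (\<forall>n::nat. diameter (int_iterate M f (int n) ` C) \<le> \<epsilon>)"

definition unstable_continuum :: "'a::metric_space set \<Rightarrow> ('a \<Rightarrow> 'a) \<Rightarrow> real \<Rightarrow> 'a set \<Rightarrow> bool" where
  "unstable_continuum M f \<epsilon> C \<longleftrightarrow>
     continuum M C \<and> (\<forall>n::nat. diameter (int_iterate M f (- int n) ` C) \<le> \<epsilon>)"

definition cw1_expansive :: "'a::metric_space set \<Rightarrow> ('a \<Rightarrow> 'a) \<Rightarrow> bool" where
  "cw1_expansive M f \<longleftrightarrow>
     (\<exists>\<xi>>0. \<forall>Cs Cu. stable_continuum M f \<xi> Cs \<and> unstable_continuum M f \<xi> Cu
        \<longrightarrow> (\<forall>x\<in>Cs \<inter> Cu. \<forall>y\<in>Cs \<inter> Cu. x = y))"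

end

theory Submission
  imports Defs
begin

text \<open>
  Let \<open>x\<close> and \<open>y\<close> lie in both a stable continuum \<open>Cs\<close> and an unstable continuum \<open>Cu\<close>. For
  \<open>q \<in> Cu\<close> and \<open>p \<in> Cs\<close> the bracket \<open>[q, p]\<close> follows \<open>p\<close> in the future and \<open>q\<close> in the past.
  But \<open>p\<close> stays close to \<open>x\<close> in the future, because \<open>Cs\<close> is stable, and \<open>q\<close> stays close to
  \<open>x\<close> in the past, because \<open>Cu\<close> is unstable. Hence the \<^emph>\<open>whole\<close> orbit of \<open>[q, p]\<close> stays close to
  that of \<open>x\<close> (lemma \<open>bracket_orbit_close\<close>). The set \<open>[Cu, Cs]\<close> is the continuous image of a
  compact connected set, so it is a continuum all of whose iterates are small, and
  cw-expansivity makes it a singleton. It contains \<open>x = [x, x]\<close> and \<open>y = [y, y]\<close>, so \<open>x = y\<close>.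

  The order of the arguments is essential: \<open>[Cs, Cu]\<close> would consist of points that
  follow \<open>Cs\<close> in the past and \<open>Cu\<close> in the future, about which nothing is known.
\<close>

lemma int_iterate_in:
  assumes "f ` M = M" and "x \<in> M"
  shows "int_iterate M f i x \<in> M"
proof -
  have "(f ^^ n) x \<in> M" for n
    using assms by (induction n) auto
  moreover have "(inv_into M f ^^ n) x \<in> M" for n
    using assms by (induction n) (auto intro: inv_into_into)
  ultimately show ?thesis
    by (simp add: int_iterate_def)
qed

text \<open>
  Compactness of \<open>M\<close> is what makes the diameter informative: on an unbounded set
  \<open>diameter\<close> is the supremum of a set of distances that is not bounded above.
\<close>

lemma dist_int_iterate_le_diameter:
  assumes "compact M" and "f ` M = M" and "C \<subseteq> M"
    and "x \<in> C" and "y \<in> C"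
  shows "dist (int_iterate M f i x) (int_iterate M f i y) \<le> diameter (int_iterate M f i ` C)"
proof -
  have "int_iterate M f i ` C \<subseteq> M"
    using int_iterate_in[OF assms(2)] assms(3) by auto
  then have "bounded (int_iterate M f i ` C)"
    using assms(1) bounded_subset compact_imp_bounded by blast
  then show ?thesis
    using assms(4,5) by (intro diameter_bounded_bound) auto
qed

lemma diameter_le_twice_radius:
  fixes c :: "'a::metric_space"
  assumes "S \<noteq> {}" and "\<And>z. z \<in> S \<Longrightarrow> dist c z \<le> r"
  shows "diameter S \<le> 2 * r"
proof -
  have "dist a b \<le> 2 * r" if "a \<in> S" "b \<in> S" for a b
    using assms(2)[OF that(1)] assms(2)[OF that(2)] dist_triangle3[of a b c] by linarith
  then show ?thesis
    using assms(1) unfolding diameter_def by (auto intro!: cSUP_least)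
qed

text \<open>
  Non-negative times are controlled by \<open>p\<close> and stability, non-positive times by \<open>q\<close> and
  instability; each costs one triangle inequality through \<open>p\<close> or \<open>q\<close>.
\<close>

lemma bracket_orbit_close:
  assumes M: "compact M" "f ` M = M"
    and Cs: "stable_continuum M f \<xi> Cs" "x \<in> Cs" "p \<in> Cs"
    and Cu: "unstable_continuum M f \<xi> Cu" "x \<in> Cu" "q \<in> Cu"
    and b: "b \<in> local_stable M f \<epsilon> p \<inter> local_unstable M f \<epsilon> q"
  shows "dist (int_iterate M f i x) (int_iterate M f i b) \<le> \<xi> + \<epsilon>"
proof -
  have sub: "Cs \<subseteq> M" "Cu \<subseteq> M"
    using Cs(1) Cu(1)
    by (auto simp: stable_continuum_def unstable_continuum_def continuum_def
        dest: closedin_imp_subset)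
  let ?F = "int_iterate M f"
  have "\<exists>z. dist (?F i x) (?F i z) \<le> \<xi> \<and> dist (?F i z) (?F i b) \<le> \<epsilon>"
  proof (cases "i \<ge> 0")
    case True
    then obtain n where i: "i = int n"
      using nonneg_int_cases by blast
    have "dist (?F i x) (?F i p) \<le> \<xi>"
      using dist_int_iterate_le_diameter[OF M sub(1) Cs(2,3), of i] Cs(1) i
      unfolding stable_continuum_def by (meson order_trans)
    then show ?thesis
      using b i by (auto simp: local_stable_def)
  next
    case False
    then obtain n where i: "i = - int n"
      by (metis int_cases2 of_nat_0_le_iff)
    have "dist (?F i x) (?F i q) \<le> \<xi>"
      using dist_int_iterate_le_diameter[OF M sub(2) Cu(2,3), of i] Cu(1) i
      unfolding unstable_continuum_def by (meson order_trans)
    then show ?thesis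
      using b i by (auto simp: local_unstable_def)
  qed
  then obtain z where "dist (?F i x) (?F i z) \<le> \<xi>" "dist (?F i z) (?F i b) \<le> \<epsilon>"
    by blast
  then show ?thesis
    using dist_triangle[of "?F i x" "?F i b" "?F i z"] by linarith
qed

theorem theorem3p11:
  fixes M :: "'a::metric_space set" and f g :: "'a \<Rightarrow> 'a"
  assumes "compact M"
    and "homeomorphism M M f g"
    and "cw_expansive M f"
    and "has_shadowing_bracket M f"
  shows "cw1_expansive M f"
proof -
  have fM: "f ` M = M"
    using assms(2) by (simp add: homeomorphism_def)
  obtain \<xi>\<^sub>0 where \<xi>\<^sub>0: "\<xi>\<^sub>0 > 0"
    and expansive: "\<And>C. continuum M C \<Longrightarrow> (\<And>i. diameter (int_iterate M f i ` C) \<le> \<xi>\<^sub>0)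
                        \<Longrightarrow> is_singleton C"
    using assms(3) unfolding cw_expansive_def by blast
  obtain \<delta> B where bracket: "shadowing_bracket M f \<delta> B"
    using assms(4) unfolding has_shadowing_bracket_def by blast
  then have B: "continuous_on (near_diagonal M \<delta>) B" "B ` near_diagonal M \<delta> \<subseteq> M"
      "\<And>p. p \<in> M \<Longrightarrow> B (p, p) = p"
    by (auto simp: shadowing_bracket_def)
  have "\<exists>\<gamma>>0. \<gamma> \<le> \<delta> \<and> (\<forall>p\<in>M. \<forall>q\<in>M. dist p q \<le> \<gamma> \<longrightarrow>
           B (p, q) \<in> local_stable M f (\<xi>\<^sub>0 / 4) q \<inter> local_unstable M f (\<xi>\<^sub>0 / 4) p)"
    using bracket[unfolded shadowing_bracket_def] \<xi>\<^sub>0 by simp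
  then obtain \<gamma> where \<gamma>: "\<gamma> > 0" "\<gamma> \<le> \<delta>"
    and shadow: "\<And>p q. p \<in> M \<Longrightarrow> q \<in> M \<Longrightarrow> dist p q \<le> \<gamma> \<Longrightarrow>
           B (p, q) \<in> local_stable M f (\<xi>\<^sub>0 / 4) q \<inter> local_unstable M f (\<xi>\<^sub>0 / 4) p"
    by metis
  \<comment> \<open>Iterates of \<open>[Cu, Cs]\<close> lie in balls of radius \<open>\<xi> + \<xi>\<^sub>0 / 4\<close>, so \<open>\<xi> \<le> \<xi>\<^sub>0 / 4\<close> bounds their
      diameters by \<open>\<xi>\<^sub>0\<close>. Points of \<open>Cu\<close> and \<open>Cs\<close> are at distance at most \<open>2 * \<xi>\<close>, passing through
      a common point, so \<open>\<xi> \<le> \<gamma> / 2\<close> puts them within the reach of the bracket.\<close>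
  define \<xi> where "\<xi> = min (\<xi>\<^sub>0 / 4) (\<gamma> / 2)"
  have \<xi>: "\<xi> > 0" "\<xi> \<le> \<xi>\<^sub>0 / 4" "\<xi> \<le> \<gamma> / 2"
    using \<xi>\<^sub>0 \<gamma> by (auto simp: \<xi>_def)
  have "x = y" if Cs: "stable_continuum M f \<xi> Cs" and Cu: "unstable_continuum M f \<xi> Cu"
    and x: "x \<in> Cs" "x \<in> Cu" and y: "y \<in> Cs" "y \<in> Cu" for Cs Cu x y
  proof -
    have cont: "closedin (top_of_set M) Cs" "closedin (top_of_set M) Cu"
      "connected Cs" "connected Cu"
      using Cs Cu by (auto simp: stable_continuum_def unstable_continuum_def continuum_def)
    then have sub: "Cs \<subseteq> M" "Cu \<subseteq> M"
      by (auto dest: closedin_imp_subset)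
    have near: "dist q p \<le> \<gamma>" if "q \<in> Cu" "p \<in> Cs" for q p
    proof -
      have "diameter Cs \<le> \<xi>" "diameter Cu \<le> \<xi>"
        using Cs[unfolded stable_continuum_def, THEN conjunct2, rule_format, of 0]
          Cu[unfolded unstable_continuum_def, THEN conjunct2, rule_format, of 0]
        by (simp_all add: int_iterate_def)
      then have "dist x p \<le> \<xi>" "dist q x \<le> \<xi>"
        using dist_int_iterate_le_diameter[OF assms(1) fM sub(1) x(1) that(2), of 0]
          dist_int_iterate_le_diameter[OF assms(1) fM sub(2) that(1) x(2), of 0]
        by (simp_all add: int_iterate_def)
      then show ?thesis
        using dist_triangle[of q p x] \<xi> by linarith
    qed
    define D where "D = B ` (Cu \<times> Cs)"
    have diag: "Cu \<times> Cs \<subseteq> near_diagonal M \<delta>"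
      using near sub \<gamma>(2) unfolding near_diagonal_def by fastforce
    then have B_cont: "continuous_on (Cu \<times> Cs) B"
      using B(1) continuous_on_subset by blast
    have "compact (Cu \<times> Cs)"
      using cont assms(1) by (intro compact_Times) (auto intro: closedin_compact)
    then have "compact D"
      unfolding D_def using B_cont by (rule compact_continuous_image[rotated])
    moreover have "D \<subseteq> M"
      unfolding D_def using diag B(2) by blast
    ultimately have "closedin (top_of_set M) D"
      by (meson closed_subset compact_imp_closed)
    moreover have "connected D"
      unfolding D_def using B_cont cont by (intro connected_continuous_image connected_Times)
    moreover have xy: "x \<in> D" "y \<in> D"
      unfolding D_def using x y sub B(3) by (force intro!: rev_image_eqI)+
    ultimately have "continuum M D"
      by (auto simp: continuum_def)
    moreover have "diameter (int_iterate M f i ` D) \<le> \<xi>\<^sub>0" for i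
    proof -
      have "dist (int_iterate M f i x) z \<le> \<xi> + \<xi>\<^sub>0 / 4" if z: "z \<in> int_iterate M f i ` D" for z
      proof -
        obtain q p where qp: "q \<in> Cu" "p \<in> Cs" "z = int_iterate M f i (B (q, p))"
          using z by (auto simp: D_def)
        then have "B (q, p) \<in> local_stable M f (\<xi>\<^sub>0 / 4) p \<inter> local_unstable M f (\<xi>\<^sub>0 / 4) q"
          using shadow near sub by blast
        then show ?thesis
          using bracket_orbit_close[OF assms(1) fM Cs x(1) qp(2) Cu x(2) qp(1)] qp(3) by blast
      qed
      then have "diameter (int_iterate M f i ` D) \<le> 2 * (\<xi> + \<xi>\<^sub>0 / 4)"
        using xy by (intro diameter_le_twice_radius) auto
      also have "\<dots> \<le> \<xi>\<^sub>0"
        using \<xi>(2) by (simp add: field_simps)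
      finally show ?thesis .
    qed
    ultimately have "is_singleton D"
      using expansive by blast
    then show "x = y"
      using xy by (metis is_singletonE singletonD)
  qed
  then show ?thesis
    unfolding cw1_expansive_def using \<xi>(1) by blast
qed

end
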